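(* Let $\mathscr{G}=(V,E)$ be a finite undirected graph, and let $\mathscr{S}_G$ be the FTS constructed from $\mathscr{G}$ as described in the context. Let $\mathscr{S}'_G$ be an FTS with the minimal number of states among all FTS that are coherent branching feature bisimilar to $\mathscr{S}_G$. Then the number of states of $\mathscr{S}'_G$ equals the chromatic number of $\mathscr{G}$ plus $2$.
   Context: Feature transition systems (FTS): given features $\mathscr{F}$, products $\mathscr{P}\subseteq 2^{\mathscr{F}}$, actions $\mathscr{A}$ and silent action $\tau$ ($\mathscr{A}_\tau=\mathscr{A}\cup\{\tau\}$), an FTS is $(S,\theta,s^\circ)$ with $\theta:S\times\mathscr{A}_\tau\times S\to\mathbb{B}(\mathscr{F})$ (Boolean expressions over $\mathscr{F}$) and initial state $s^\circ$. $P\models\varphi$ means $\varphi$ is true when features in $P$ are true and others false; feature expressions are identified modulo $\varphi\sim_{\mathscr{P}}\psi$ (same products in $\mathscr{P}$ satisfy them), $\hat\varphi$ being the class. Write $s\xrightarrow{\alpha|\psi}s'$ if $\theta(s,\alpha,s')=\psi$ is satisfiable. The reachability function $\varrho$ satisfies: $P\models\varrho(s)$ iff $s$ is reachable from $s^\circ$ by transitions whose constraints $P$ satisfies. $s\Rightarrow_\eta s'$ denotes a possibly empty sequence of $\tau$-transitions from $s$ to $s'$ whose constraints have conjunction $\eta$; $s\xrightarrow{(\alpha|\psi)}s'$ means $s\xrightarrow{\alpha|\psi}s'$ or ($\alpha=\tau$, $s=s'$, $\psi=\mathit{true}$). A symmetric relation $R$ on states $\times$ classes of feature expressions $\times$ states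 (of the disjoint union of two FTS) is a branching feature bisimulation if whenever $R(s,\hat\varphi,t)$ and $s\xrightarrow{\alpha|\psi}s'$, there are $n$ and, for $i\le n$, $\hat t_i,t'_i,\eta_i,\psi_i,\varphi_i,\varphi'_i$ with $t\Rightarrow_{\eta_i}\hat t_i\xrightarrow{(\alpha|\psi_i)}t'_i$, $R(s,\hat\varphi_i,\hat t_i)$, $R(s',\hat\varphi'_i,t'_i)$, and every $P\in\mathscr{P}$ with $P\models\varphi\wedge\psi$ satisfies $\bigvee_i(\eta_i\wedge\psi_i\wedge\varphi_i\wedge\varphi'_i)$. It is coherent (for $\mathscr{S},\mathscr{S}'$) if $R(s,\hat\varphi,s')$ with $s$ in $\mathscr{S}$ implies every product satisfying $\varrho(s)$ satisfies $\varphi$. Two FTS are coherent branching feature bisimilar if such a coherent relation relates their initial states by $\widehat{\mathit{true}}$. Construction: $\mathscr{A}=\{a\}$, $\mathscr{F}=\{f_v\mid v\in V\}$, $\mathscr{P}=\{P_v\mid v\in V\}$ with $P_v=\{f_v\}$. $\mathscr{S}_G=(S_G,\theta_G,s_1)$ with $S_G=\{s_1,s_2\}\cup\{s_v\mid v\in V\}$ (all distinct), $\theta_G(s_1,a,s_v)=\bigvee\{f_u\mid \{u,v\}\in E\}\vee f_v$ for all $v\in V$, $\theta_G(s_v,a,s_2)=f_v$ for all $v\in V$, and $\theta_G(s,\alpha,s')=\mathit{false}$ in all other cases.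
   Formalization: The graph is assumed to be loop-free (otherwise the chromatic number is undefined) and to have at least one vertex: for the empty graph there are no products, a one-state FTS is bisimilar to S_G, and the claimed count 0+2 fails. *)

theory Defs
  imports Main "HOL-Library.Equipollence"
begin

section \<open>Feature expressions\<close>

datatype 'f fexp =
    FTrue
  | FFalse
  | Atom 'f
  | Neg "'f fexp"
  | And "'f fexp" "'f fexp"
  | Or "'f fexp" "'f fexp"

primrec sat :: "'f set \<Rightarrow> 'f fexp \<Rightarrow> bool" (infix \<open>\<Turnstile>\<close> 50) where
  "P \<Turnstile> FTrue \<longleftrightarrow> True"
| "P \<Turnstile> FFalse \<longleftrightarrow> False"
| "P \<Turnstile> Atom f \<longleftrightarrow> f \<in> P"
| "P \<Turnstile> Neg \<phi> \<longleftrightarrow> \<not> P \<Turnstile> \<phi>"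
| "P \<Turnstile> And \<phi> \<psi> \<longleftrightarrow> P \<Turnstile> \<phi> \<and> P \<Turnstile> \<psi>"
| "P \<Turnstile> Or \<phi> \<psi> \<longleftrightarrow> P \<Turnstile> \<phi> \<or> P \<Turnstile> \<psi>"

definition fexps :: "'f set \<Rightarrow> 'f fexp set" where
  "fexps F = {\<phi>. set_fexp \<phi> \<subseteq> F}"

text \<open>Disjunction of a finite set of expressions, in an arbitrary order.\<close>

definition big_or :: "'f fexp set \<Rightarrow> 'f fexp" where
  "big_or \<Phi> = foldr Or (SOME xs. set xs = \<Phi>) FFalse"

lemma set_some_list: "finite A \<Longrightarrow> set (SOME xs. set xs = A) = A"
  by (rule someI_ex) (rule finite_list)

lemma sat_big_or:
  assumes "finite \<Phi>"
  shows "P \<Turnstile> big_or \<Phi> \<longleftrightarrow> (\<exists>\<phi>\<in>\<Phi>. P \<Turnstile> \<phi>)"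
proof -
  have "P \<Turnstile> foldr Or xs FFalse \<longleftrightarrow> (\<exists>\<phi>\<in>set xs. P \<Turnstile> \<phi>)" for xs
    by (induction xs) auto
  then show ?thesis
    unfolding big_or_def by (simp add: set_some_list[OF assms])
qed

lemma big_or_in_fexps:
  assumes "finite \<Phi>" "\<Phi> \<subseteq> fexps F"
  shows "big_or \<Phi> \<in> fexps F"
proof -
  have "set xs \<subseteq> fexps F \<Longrightarrow> foldr Or xs FFalse \<in> fexps F" for xs
    by (induction xs) (auto simp: fexps_def)
  then show ?thesis
    unfolding big_or_def using assms(2) by (simp add: set_some_list[OF assms(1)])
qed

text \<open>In the following, \<open>F\<close> is the set of features and \<open>Ps\<close> the set of products.\<close>

definition feq :: "'f set \<Rightarrow> 'f set set \<Rightarrow> ('f fexp \<times> 'f fexp) set" where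
  "feq F Ps = {(\<phi>, \<psi>). \<phi> \<in> fexps F \<and> \<psi> \<in> fexps F \<and> (\<forall>P\<in>Ps. P \<Turnstile> \<phi> \<longleftrightarrow> P \<Turnstile> \<psi>)}"

lemma equiv_feq: "equiv (fexps F) (feq F Ps)"
  by (rule equivI) (auto simp: feq_def refl_on_def sym_def trans_def)

definition fclass :: "'f set \<Rightarrow> 'f set set \<Rightarrow> 'f fexp \<Rightarrow> 'f fexp set" where
  "fclass F Ps \<phi> = feq F Ps `` {\<phi>}"

text \<open>Satisfiability is relative to the products, so that it is invariant under \<open>feq\<close>.\<close>

definition satisfiable :: "'f set set \<Rightarrow> 'f fexp \<Rightarrow> bool" where
  "satisfiable Ps \<phi> \<longleftrightarrow> (\<exists>P\<in>Ps. P \<Turnstile> \<phi>)"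


section \<open>Feature transition systems\<close>

text \<open>The set of visible actions is the whole type \<open>'a\<close>.\<close>

datatype 'a act = Tau | Act 'a

record ('f, 'a, 's) fts =
  states :: "'s set"
  constr :: "'s \<Rightarrow> 'a act \<Rightarrow> 's \<Rightarrow> 'f fexp"
  init :: 's

definition is_fts :: "'f set \<Rightarrow> ('f, 'a, 's) fts \<Rightarrow> bool" where
  "is_fts F M \<longleftrightarrow>
     init M \<in> states M \<and>
     (\<forall>s\<in>states M. \<forall>\<alpha>. \<forall>s'\<in>states M. constr M s \<alpha> s' \<in> fexps F)"

definition step ::
  "'f set set \<Rightarrow> ('f, 'a, 's) fts \<Rightarrow> 's \<Rightarrow> 'a act \<Rightarrow> 'f fexp \<Rightarrow> 's \<Rightarrow> bool" where
  "step Ps M s \<alpha> \<psi> s' \<longleftrightarrow>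
     s \<in> states M \<and> s' \<in> states M \<and> constr M s \<alpha> s' = \<psi> \<and> satisfiable Ps \<psi>"

definition opt_step ::
  "'f set set \<Rightarrow> ('f, 'a, 's) fts \<Rightarrow> 's \<Rightarrow> 'a act \<Rightarrow> 'f fexp \<Rightarrow> 's \<Rightarrow> bool" where
  "opt_step Ps M s \<alpha> \<psi> s' \<longleftrightarrow>
     step Ps M s \<alpha> \<psi> s' \<or> (s \<in> states M \<and> \<alpha> = Tau \<and> s = s' \<and> \<psi> = FTrue)"

inductive tau_steps ::
  "'f set set \<Rightarrow> ('f, 'a, 's) fts \<Rightarrow> 's \<Rightarrow> 'f fexp \<Rightarrow> 's \<Rightarrow> bool"
  for Ps :: "'f set set" and M :: "('f, 'a, 's) fts" where
  empty: "s \<in> states M \<Longrightarrow> tau_steps Ps M s FTrue s"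
| cons: "step Ps M s Tau \<psi> s' \<Longrightarrow> tau_steps Ps M s' \<eta> s'' \<Longrightarrow> tau_steps Ps M s (And \<psi> \<eta>) s''"

inductive reachable ::
  "'f set set \<Rightarrow> ('f, 'a, 's) fts \<Rightarrow> 'f set \<Rightarrow> 's \<Rightarrow> bool"
  for Ps :: "'f set set" and M :: "('f, 'a, 's) fts" and P :: "'f set" where
  init: "reachable Ps M P (init M)"
| step: "reachable Ps M P s \<Longrightarrow> step Ps M s \<alpha> \<psi> s' \<Longrightarrow> P \<Turnstile> \<psi> \<Longrightarrow> reachable Ps M P s'"

text \<open>The reachability function is determined up to \<open>feq\<close>.\<close>

definition reach_fexp :: "'f set \<Rightarrow> 'f set set \<Rightarrow> ('f, 'a, 's) fts \<Rightarrow> 's \<Rightarrow> 'f fexp" where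
  "reach_fexp F Ps M s =
     (SOME \<rho>. \<rho> \<in> fexps F \<and> (\<forall>P\<in>Ps. P \<Turnstile> \<rho> \<longleftrightarrow> reachable Ps M P s))"

lemma fexp_of_products:
  fixes F :: "'f set"
  assumes "finite F" "Q \<subseteq> Pow F"
  shows "\<exists>\<phi>\<in>fexps F. \<forall>P\<subseteq>F. P \<Turnstile> \<phi> \<longleftrightarrow> P \<in> Q"
proof -
  define chi :: "'f set \<Rightarrow> 'f fexp"
    where "chi P = Neg (big_or ((\<lambda>f. if f \<in> P then Neg (Atom f) else Atom f) ` F))" for P
  have chi_fexps: "chi P \<in> fexps F" for P
  proof -
    have "big_or ((\<lambda>f. if f \<in> P then Neg (Atom f) else Atom f) ` F) \<in> fexps F"
      using assms(1) by (intro big_or_in_fexps finite_imageI image_subsetI) (simp_all add: fexps_def)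
    then show ?thesis by (simp add: chi_def fexps_def)
  qed
  have chi_sat: "P \<Turnstile> chi P' \<longleftrightarrow> P = P'" if "P \<subseteq> F" "P' \<subseteq> F" for P P'
  proof -
    have "P \<Turnstile> chi P' \<longleftrightarrow> (\<forall>f\<in>F. \<not> P \<Turnstile> (if f \<in> P' then Neg (Atom f) else Atom f))"
      unfolding chi_def by (simp only: sat.simps sat_big_or[OF finite_imageI[OF assms(1)]] bex_simps)
    also have "\<dots> \<longleftrightarrow> (\<forall>f\<in>F. f \<in> P \<longleftrightarrow> f \<in> P')"
      by (intro ball_cong refl) simp
    also have "\<dots> \<longleftrightarrow> P = P'"
    proof
      assume *: "\<forall>f\<in>F. f \<in> P \<longleftrightarrow> f \<in> P'"
      show "P = P'"
      proof (rule set_eqI)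
        show "f \<in> P \<longleftrightarrow> f \<in> P'" for f
          using * that by (cases "f \<in> F") (simp, meson subsetD)
      qed
    qed simp
    finally show ?thesis .
  qed
  have fin: "finite Q"
    by (rule finite_subset[OF assms(2)]) (simp add: assms(1))
  show ?thesis
  proof (intro bexI allI impI)
    show "big_or (chi ` Q) \<in> fexps F"
      using fin chi_fexps by (intro big_or_in_fexps finite_imageI image_subsetI)
    show "P \<Turnstile> big_or (chi ` Q) \<longleftrightarrow> P \<in> Q" if "P \<subseteq> F" for P
    proof -
      have "P \<Turnstile> big_or (chi ` Q) \<longleftrightarrow> (\<exists>P'\<in>Q. P \<Turnstile> chi P')"
        by (simp only: sat_big_or[OF finite_imageI[OF fin]] bex_simps)
      also have "\<dots> \<longleftrightarrow> (\<exists>P'\<in>Q. P = P')"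
        by (rule bex_cong[OF refl], rule chi_sat[OF that]) (use assms(2) in auto)
      finally show ?thesis by blast
    qed
  qed
qed

lemma reach_fexp:
  assumes "finite F" "Ps \<subseteq> Pow F"
  shows "reach_fexp F Ps M s \<in> fexps F"
    and "P \<in> Ps \<Longrightarrow> P \<Turnstile> reach_fexp F Ps M s \<longleftrightarrow> reachable Ps M P s"
proof -
  have "{P \<in> Ps. reachable Ps M P s} \<subseteq> Pow F"
    using assms(2) by auto
  from fexp_of_products[OF assms(1) this] obtain \<rho> where
    "\<rho> \<in> fexps F" "\<forall>P\<subseteq>F. P \<Turnstile> \<rho> \<longleftrightarrow> P \<in> {P \<in> Ps. reachable Ps M P s}" ..
  moreover have "\<forall>P\<in>Ps. P \<subseteq> F"
    using assms(2) by auto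
  ultimately have "\<exists>\<rho>. \<rho> \<in> fexps F \<and> (\<forall>P\<in>Ps. P \<Turnstile> \<rho> \<longleftrightarrow> reachable Ps M P s)"
    by (intro exI[of _ \<rho>]) simp
  then have *: "reach_fexp F Ps M s \<in> fexps F \<and>
      (\<forall>P\<in>Ps. P \<Turnstile> reach_fexp F Ps M s \<longleftrightarrow> reachable Ps M P s)"
    unfolding reach_fexp_def by (rule someI_ex)
  show "reach_fexp F Ps M s \<in> fexps F"
    using * by blast
  show "P \<in> Ps \<Longrightarrow> P \<Turnstile> reach_fexp F Ps M s \<longleftrightarrow> reachable Ps M P s"
    using * by blast
qed

fun union_constr ::
  "('f, 'a, 's) fts \<Rightarrow> ('f, 'a, 't) fts \<Rightarrow> 's + 't \<Rightarrow> 'a act \<Rightarrow> 's + 't \<Rightarrow> 'f fexp" where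
  "union_constr M N (Inl s) \<alpha> (Inl s') = constr M s \<alpha> s'"
| "union_constr M N (Inr t) \<alpha> (Inr t') = constr N t \<alpha> t'"
| "union_constr M N _ _ _ = FFalse"

text \<open>Only the states and transitions of the disjoint union are used; its initial state is
  a dummy.\<close>

definition fts_union :: "('f, 'a, 's) fts \<Rightarrow> ('f, 'a, 't) fts \<Rightarrow> ('f, 'a, 's + 't) fts" where
  "fts_union M N =
     \<lparr>states = states M <+> states N, constr = union_constr M N, init = Inl (init M)\<rparr>"


section \<open>Coherent branching feature bisimilarity\<close>

text \<open>The number \<open>n\<close> of matching runs may be 0, in which case the disjunction is false and
  no product satisfies \<open>And \<phi> \<psi>\<close>.\<close>

definition branching_feature_bisimulation ::
  "'f set \<Rightarrow> 'f set set \<Rightarrow> ('f, 'a, 's) fts \<Rightarrow> ('s \<times> 'f fexp set \<times> 's) set \<Rightarrow> bool" where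
  "branching_feature_bisimulation F Ps M R \<longleftrightarrow>
     R \<subseteq> states M \<times> (fexps F // feq F Ps) \<times> states M \<and>
     (\<forall>s c t. (s, c, t) \<in> R \<longrightarrow> (t, c, s) \<in> R) \<and>
     (\<forall>s t s' \<alpha>. \<forall>\<phi>\<in>fexps F. \<forall>\<psi>.
        (s, fclass F Ps \<phi>, t) \<in> R \<and> step Ps M s \<alpha> \<psi> s' \<longrightarrow>
        (\<exists>(n::nat) u t' \<eta> \<psi>' \<phi>1 \<phi>2.
           (\<forall>i\<in>{1..n}.
              tau_steps Ps M t (\<eta> i) (u i) \<and>
              opt_step Ps M (u i) \<alpha> (\<psi>' i) (t' i) \<and>
              \<phi>1 i \<in> fexps F \<and> (s, fclass F Ps (\<phi>1 i), u i) \<in> R \<and>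
              \<phi>2 i \<in> fexps F \<and> (s', fclass F Ps (\<phi>2 i), t' i) \<in> R) \<and>
           (\<forall>P\<in>Ps. P \<Turnstile> And \<phi> \<psi> \<longrightarrow>
              P \<Turnstile> big_or ((\<lambda>i. And (\<eta> i) (And (\<psi>' i) (And (\<phi>1 i) (\<phi>2 i)))) ` {1..n}))))"

text \<open>Coherence refers to reachability in the first system only.\<close>

definition coherent ::
  "'f set \<Rightarrow> 'f set set \<Rightarrow> ('f, 'a, 's) fts \<Rightarrow>
   (('s + 't) \<times> 'f fexp set \<times> ('s + 't)) set \<Rightarrow> bool" where
  "coherent F Ps M R \<longleftrightarrow>
     (\<forall>s\<in>states M. \<forall>t. \<forall>\<phi>\<in>fexps F. (Inl s, fclass F Ps \<phi>, t) \<in> R \<longrightarrow>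
        (\<forall>P\<in>Ps. P \<Turnstile> reach_fexp F Ps M s \<longrightarrow> P \<Turnstile> \<phi>))"

definition coherent_bf_bisimilar ::
  "'f set \<Rightarrow> 'f set set \<Rightarrow> ('f, 'a, 's) fts \<Rightarrow> ('f, 'a, 't) fts \<Rightarrow> bool" where
  "coherent_bf_bisimilar F Ps M N \<longleftrightarrow>
     (\<exists>R. branching_feature_bisimulation F Ps (fts_union M N) R \<and> coherent F Ps M R \<and>
          (Inl (init M), fclass F Ps FTrue, Inr (init N)) \<in> R)"

text \<open>HOL cannot quantify over the state type of the competitors \<open>L\<close>.  Ranging over state sets
  included in \<open>nat\<close> loses nothing for a finite \<open>M\<close>: every finite system is isomorphic to one of
  these, and an infinite competitor imposes no further constraint because (a copy of) \<open>M\<close>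
  itself is a finite competitor.\<close>

definition minimal_coherent_bf_bisimilar ::
  "'f set \<Rightarrow> 'f set set \<Rightarrow> ('f, 'a, 's) fts \<Rightarrow> ('f, 'a, 't) fts \<Rightarrow> bool" where
  "minimal_coherent_bf_bisimilar F Ps M N \<longleftrightarrow>
     is_fts F N \<and> coherent_bf_bisimilar F Ps M N \<and>
     (\<forall>L :: ('f, 'a, nat) fts. is_fts F L \<and> coherent_bf_bisimilar F Ps M L \<longrightarrow>
        states N \<lesssim> states L)"


section \<open>Graphs and the associated feature transition system\<close>

text \<open>Graphs are simple, since loops admit no proper colouring, and have a vertex: without
  vertices there are no products, and all systems are coherent branching feature bisimilar.\<close>

definition finite_graph :: "'v set \<Rightarrow> 'v set set \<Rightarrow> bool" where
  "finite_graph V E \<longleftrightarrow> finite V \<and> V \<noteq> {} \<and> (\<forall>e\<in>E. e \<subseteq> V \<and> card e = 2)"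

definition proper_colouring :: "'v set \<Rightarrow> 'v set set \<Rightarrow> nat \<Rightarrow> ('v \<Rightarrow> nat) \<Rightarrow> bool" where
  "proper_colouring V E k c \<longleftrightarrow>
     c ` V \<subseteq> {..<k} \<and> (\<forall>u\<in>V. \<forall>v\<in>V. {u, v} \<in> E \<longrightarrow> c u \<noteq> c v)"

definition chromatic_number :: "'v set \<Rightarrow> 'v set set \<Rightarrow> nat" where
  "chromatic_number V E = (LEAST k. \<exists>c. proper_colouring V E k c)"

datatype 'v feature = Feature 'v

definition graph_features :: "'v set \<Rightarrow> 'v feature set" where
  "graph_features V = {Feature v |v. v \<in> V}"

definition graph_products :: "'v set \<Rightarrow> 'v feature set set" where
  "graph_products V = {{Feature v} |v. v \<in> V}"

datatype 'v gstate = S1 | S2 | SV 'v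

text \<open>The alphabet is the one-element type \<open>unit\<close>.\<close>

fun graph_constr ::
  "'v set set \<Rightarrow> 'v gstate \<Rightarrow> unit act \<Rightarrow> 'v gstate \<Rightarrow> 'v feature fexp" where
  "graph_constr E S1 (Act ()) (SV v) =
     Or (big_or {Atom (Feature u) |u. {u, v} \<in> E}) (Atom (Feature v))"
| "graph_constr E (SV v) (Act ()) S2 = Atom (Feature v)"
| "graph_constr E _ _ _ = FFalse"

definition graph_fts :: "'v set \<Rightarrow> 'v set set \<Rightarrow> ('v feature, unit, 'v gstate) fts" where
  "graph_fts V E = \<lparr>states = {S1, S2} \<union> SV ` V, constr = graph_constr E, init = S1\<rparr>"

end

theory Submission
  imports Defs
begin

text \<open>
  Fixing a product turns a branching feature bisimulation into an ordinary branching bisimulation,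
  and coherence says that a related pair stays related under all products that reach its first
  component.

  Lower bound: every reachable state \<open>s\<close> of the first system is thus matched by a single state
  \<open>g s\<close> of the competitor, for all products reaching \<open>s\<close> at once. If \<open>g s = g r\<close>, then \<open>s\<close> and
  \<open>r\<close> are branching bisimilar for each product that reaches both. In the system of a graph, the
  product of \<open>u\<close> reaches \<open>SV v\<close> for the \<open>v\<close> in the closed neighbourhood of \<open>u\<close>, but among these
  only \<open>SV u\<close> can move. So \<open>g\<close> colours the graph properly and uses two further values, at \<open>S1\<close>
  and \<open>S2\<close>.

  Upper bound: given a proper colouring, identify the states of vertices of equal colour. As no
  neighbour of \<open>u\<close> shares its colour, no state reachable for the product of \<open>u\<close> acquires new
  behaviour.
\<close>

section \<open>Branching bisimulations\<close>

abbreviation silent_steps :: "('s \<Rightarrow> 'a act \<Rightarrow> 's \<Rightarrow> bool) \<Rightarrow> 's \<Rightarrow> 's \<Rightarrow> bool" where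
  "silent_steps T \<equiv> (\<lambda>s s'. T s Tau s')\<^sup>*\<^sup>*"

definition branching_match ::
  "('s \<Rightarrow> 'a act \<Rightarrow> 's \<Rightarrow> bool) \<Rightarrow> ('s \<Rightarrow> 's \<Rightarrow> bool) \<Rightarrow> 's \<Rightarrow> 's \<Rightarrow> 'a act \<Rightarrow> 's \<Rightarrow> bool" where
  "branching_match T B s t \<alpha> s' \<longleftrightarrow>
     (\<exists>u t'. silent_steps T t u \<and> (T u \<alpha> t' \<or> \<alpha> = Tau \<and> u = t') \<and> B s u \<and> B s' t')"

definition branching_bisimulation ::
  "('s \<Rightarrow> 'a act \<Rightarrow> 's \<Rightarrow> bool) \<Rightarrow> ('s \<Rightarrow> 's \<Rightarrow> bool) \<Rightarrow> bool" where
  "branching_bisimulation T B \<longleftrightarrow>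
     symp B \<and> (\<forall>s t \<alpha> s'. B s t \<longrightarrow> T s \<alpha> s' \<longrightarrow> branching_match T B s t \<alpha> s')"

definition branching_bisimilar :: "('s \<Rightarrow> 'a act \<Rightarrow> 's \<Rightarrow> bool) \<Rightarrow> 's \<Rightarrow> 's \<Rightarrow> bool" where
  "branching_bisimilar T s t \<longleftrightarrow> (\<exists>B. branching_bisimulation T B \<and> B s t)"

lemma branching_bisimulation_symD:
  "branching_bisimulation T B \<Longrightarrow> B s t \<Longrightarrow> B t s"
  by (auto simp: branching_bisimulation_def dest: sympD)

lemma branching_bisimulation_stepE:
  assumes "branching_bisimulation T B" "B s t" "T s \<alpha> s'"
  obtains u t' where "silent_steps T t u" "T u \<alpha> t' \<or> \<alpha> = Tau \<and> u = t'" "B s u" "B s' t'"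
  using assms unfolding branching_bisimulation_def branching_match_def by blast

lemma branching_bisimulation_silent_steps:
  assumes "branching_bisimulation T B" "silent_steps T s s'" "B s t"
  shows "\<exists>t'. silent_steps T t t' \<and> B s' t'"
  using assms(2,3)
proof (induction rule: rtranclp_induct)
  case (step y z)
  then obtain w where w: "silent_steps T t w" "B y w"
    by blast
  from branching_bisimulation_stepE[OF assms(1) w(2) step.hyps(2)] obtain u t' where
    "silent_steps T w u" "T u Tau t' \<or> u = t'" "B z t'"
    by metis
  with w(1) show ?case
    by (metis (no_types, lifting) rtranclp.rtrancl_into_rtrancl rtranclp_trans)
qed blast

text \<open>Bisimulations compose because a silent step may be matched by any silent run to a state related
  to both its source and its target (semi-branching bisimulation).\<close>

lemma branching_bisimulation_relcompp:
  assumes B: "branching_bisimulation T B"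
  shows "branching_bisimulation T (B OO B)"
  unfolding branching_bisimulation_def
proof (intro conjI allI impI)
  show "symp (B OO B)"
    using branching_bisimulation_symD[OF B] by (auto intro!: sympI)
next
  fix s r \<alpha> s'
  assume "(B OO B) s r" and st: "T s \<alpha> s'"
  then obtain t where t: "B s t" "B t r"
    by blast
  obtain u t' where u: "silent_steps T t u" "T u \<alpha> t' \<or> \<alpha> = Tau \<and> u = t'" "B s u" "B s' t'"
    using B t(1) st by (rule branching_bisimulation_stepE)
  obtain w where w: "silent_steps T r w" "B u w"
    using branching_bisimulation_silent_steps[OF B u(1) t(2)] by blast
  from u(2) show "branching_match T (B OO B) s r \<alpha> s'"
  proof
    assume "T u \<alpha> t'"
    with B w(2) obtain w' r' where
      "silent_steps T w w'" "T w' \<alpha> r' \<or> \<alpha> = Tau \<and> w' = r'" "B u w'" "B t' r'"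
      by (rule branching_bisimulation_stepE)
    moreover have "silent_steps T r w'"
      using w(1) \<open>silent_steps T w w'\<close> by (rule rtranclp_trans)
    ultimately show ?thesis
      unfolding branching_match_def using u(3,4) by blast
  next
    assume "\<alpha> = Tau \<and> u = t'"
    with w u(3,4) show ?thesis
      unfolding branching_match_def by blast
  qed
qed

lemma silent_steps_image:
  assumes "\<And>s \<alpha> y. T (f s) \<alpha> y \<longleftrightarrow> (\<exists>s'. y = f s' \<and> T' s \<alpha> s')" "silent_steps T (f s) y"
  shows "\<exists>s'. y = f s' \<and> silent_steps T' s s'"
  using assms(2)
proof (induction rule: rtranclp_induct)
  case (step y z)
  then obtain u u' where "z = f u'" "silent_steps T' s u" "T' u Tau u'"
    using assms(1) by blast
  then show ?case
    by (blast intro: rtranclp.rtrancl_into_rtrancl)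
qed blast

lemma branching_bisimulation_vimage:
  assumes T: "\<And>s \<alpha> y. T (f s) \<alpha> y \<longleftrightarrow> (\<exists>s'. y = f s' \<and> T' s \<alpha> s')"
    and B: "branching_bisimulation T B"
  shows "branching_bisimulation T' (\<lambda>s t. B (f s) (f t))"
  unfolding branching_bisimulation_def
proof (intro conjI allI impI)
  show "symp (\<lambda>s t. B (f s) (f t))"
    using branching_bisimulation_symD[OF B] by (auto intro!: sympI)
next
  fix s t \<alpha> s'
  assume related: "B (f s) (f t)" and "T' s \<alpha> s'"
  then have "T (f s) \<alpha> (f s')"
    by (auto simp: T)
  with B related obtain y y' where y: "silent_steps T (f t) y" "T y \<alpha> y' \<or> \<alpha> = Tau \<and> y = y'"
    "B (f s) y" "B (f s') y'"
    by (rule branching_bisimulation_stepE)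
  obtain u where u: "y = f u" "silent_steps T' t u"
    using silent_steps_image[of T f T', OF T y(1)] by blast
  from y(2) obtain t' where "y' = f t'" "T' u \<alpha> t' \<or> \<alpha> = Tau \<and> u = t'"
    by (auto simp: u(1) T)
  with u y(3,4) show "branching_match T' (\<lambda>s t. B (f s) (f t)) s t \<alpha> s'"
    unfolding branching_match_def by blast
qed

lemma branching_bisimilar_sym:
  "branching_bisimilar T s t \<Longrightarrow> branching_bisimilar T t s"
  unfolding branching_bisimilar_def by (auto dest: branching_bisimulation_symD)

lemma branching_bisimilar_visible_step:
  assumes "branching_bisimilar T s t" "T s (Act a) s'" and tau_free: "\<And>t'. \<not> T t Tau t'"
  shows "\<exists>t'. T t (Act a) t' \<and> branching_bisimilar T s' t'"
proof -
  obtain B where B: "branching_bisimulation T B" "B s t"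
    using assms(1) by (auto simp: branching_bisimilar_def)
  then obtain u t' where "silent_steps T t u" and visible: "T u (Act a) t'" and "B s' t'"
    using assms(2) by (rule branching_bisimulation_stepE) simp
  from \<open>silent_steps T t u\<close> have "u = t"
    using tau_free by (auto elim: converse_rtranclpE)
  with visible B(1) \<open>B s' t'\<close> show ?thesis
    by (auto simp: branching_bisimilar_def)
qed

section \<open>Fixing a product\<close>

definition product_step :: "'f set \<Rightarrow> ('f, 'a, 's) fts \<Rightarrow> 's \<Rightarrow> 'a act \<Rightarrow> 's \<Rightarrow> bool" where
  "product_step P M s \<alpha> s' \<longleftrightarrow> s \<in> states M \<and> s' \<in> states M \<and> P \<Turnstile> constr M s \<alpha> s'"

definition product_rel ::
  "'f set \<Rightarrow> 'f set set \<Rightarrow> ('s \<times> 'f fexp set \<times> 's) set \<Rightarrow> 'f set \<Rightarrow> 's \<Rightarrow> 's \<Rightarrow> bool" where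
  "product_rel F Ps R P s t \<longleftrightarrow> (\<exists>\<phi>\<in>fexps F. (s, fclass F Ps \<phi>, t) \<in> R \<and> P \<Turnstile> \<phi>)"

lemma fclass_eq_iff:
  assumes "\<phi> \<in> fexps F" "\<psi> \<in> fexps F"
  shows "fclass F Ps \<phi> = fclass F Ps \<psi> \<longleftrightarrow> (\<forall>P\<in>Ps. P \<Turnstile> \<phi> \<longleftrightarrow> P \<Turnstile> \<psi>)"
  using eq_equiv_class_iff[OF equiv_feq assms] assms by (auto simp: fclass_def feq_def)

lemma product_step_iff_step:
  "P \<in> Ps \<Longrightarrow> product_step P M s \<alpha> s' \<longleftrightarrow> (\<exists>\<psi>. step Ps M s \<alpha> \<psi> s' \<and> P \<Turnstile> \<psi>)"
  by (auto simp: product_step_def step_def satisfiable_def)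

lemma opt_step_iff_product_step:
  assumes "P \<in> Ps" "u \<in> states M"
  shows "(\<exists>\<psi>. opt_step Ps M u \<alpha> \<psi> t \<and> P \<Turnstile> \<psi>) \<longleftrightarrow> product_step P M u \<alpha> t \<or> \<alpha> = Tau \<and> u = t"
  using assms by (auto simp: product_step_iff_step opt_step_def)

lemma tau_steps_in_states: "tau_steps Ps M t \<eta> u \<Longrightarrow> u \<in> states M"
  by (induction rule: tau_steps.induct)

lemma tau_steps_iff_silent_steps:
  assumes "P \<in> Ps" "t \<in> states M"
  shows "(\<exists>\<eta>. tau_steps Ps M t \<eta> u \<and> P \<Turnstile> \<eta>) \<longleftrightarrow> silent_steps (product_step P M) t u"
    (is "?runs t \<longleftrightarrow> _")
proof
  assume "?runs t"
  then obtain \<eta> where "tau_steps Ps M t \<eta> u" "P \<Turnstile> \<eta>"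
    by blast
  then show "silent_steps (product_step P M) t u"
  proof induction
    case (cons s \<psi> s' \<eta> s'')
    then have "product_step P M s Tau s'" "silent_steps (product_step P M) s' s''"
      using assms(1) by (auto simp: product_step_iff_step)
    then show ?case
      by (rule converse_rtranclp_into_rtranclp)
  qed simp
next
  assume "silent_steps (product_step P M) t u"
  then show "?runs t"
    using assms(2)
  proof (induction rule: converse_rtranclp_induct)
    case base
    then show ?case
      by (auto intro!: exI[of _ FTrue] tau_steps.empty)
  next
    case (step y z)
    then obtain \<psi> \<eta> where "step Ps M y Tau \<psi> z" "P \<Turnstile> \<psi>" "tau_steps Ps M z \<eta> u" "P \<Turnstile> \<eta>"
      using assms(1) by (auto simp: product_step_iff_step step_def)
    then show ?case
      by (auto intro!: exI[of _ "And \<psi> \<eta>"] tau_steps.cons)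
  qed
qed

definition matching_run ::
  "'f set \<Rightarrow> 'f set set \<Rightarrow> ('f, 'a, 's) fts \<Rightarrow> ('s \<times> 'f fexp set \<times> 's) set \<Rightarrow> 's \<Rightarrow> 's \<Rightarrow> 'a act \<Rightarrow> 's \<Rightarrow>
   's \<Rightarrow> 's \<Rightarrow> 'f fexp \<Rightarrow> 'f fexp \<Rightarrow> 'f fexp \<Rightarrow> 'f fexp \<Rightarrow> bool" where
  "matching_run F Ps M R s t \<alpha> s' u t' \<eta> \<psi> \<phi>1 \<phi>2 \<longleftrightarrow>
     tau_steps Ps M t \<eta> u \<and> opt_step Ps M u \<alpha> \<psi> t' \<and>
     \<phi>1 \<in> fexps F \<and> (s, fclass F Ps \<phi>1, u) \<in> R \<and> \<phi>2 \<in> fexps F \<and> (s', fclass F Ps \<phi>2, t') \<in> R"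

lemma branching_match_iff_matching_run:
  assumes "P \<in> Ps" "t \<in> states M"
  shows "branching_match (product_step P M) (product_rel F Ps R P) s t \<alpha> s' \<longleftrightarrow>
    (\<exists>u t' \<eta> \<psi> \<phi>1 \<phi>2. matching_run F Ps M R s t \<alpha> s' u t' \<eta> \<psi> \<phi>1 \<phi>2 \<and>
       P \<Turnstile> And \<eta> (And \<psi> (And \<phi>1 \<phi>2)))"
    (is "_ \<longleftrightarrow> ?runs")
proof
  assume "branching_match (product_step P M) (product_rel F Ps R P) s t \<alpha> s'"
  then obtain u t' where u: "silent_steps (product_step P M) t u"
    "product_step P M u \<alpha> t' \<or> \<alpha> = Tau \<and> u = t'"
    and rel: "product_rel F Ps R P s u" "product_rel F Ps R P s' t'"
    unfolding branching_match_def by blast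
  obtain \<eta> where \<eta>: "tau_steps Ps M t \<eta> u" "P \<Turnstile> \<eta>"
    using u(1) tau_steps_iff_silent_steps[OF assms] by blast
  obtain \<psi> where "opt_step Ps M u \<alpha> \<psi> t'" "P \<Turnstile> \<psi>"
    using u(2) opt_step_iff_product_step[OF assms(1) tau_steps_in_states[OF \<eta>(1)]] by blast
  with \<eta> rel show ?runs
    unfolding product_rel_def matching_run_def sat.simps by blast
next
  assume ?runs
  then obtain u t' \<eta> \<psi> \<phi>1 \<phi>2 where run: "matching_run F Ps M R s t \<alpha> s' u t' \<eta> \<psi> \<phi>1 \<phi>2"
    and sat: "P \<Turnstile> \<eta>" "P \<Turnstile> \<psi>" "P \<Turnstile> \<phi>1" "P \<Turnstile> \<phi>2"
    by auto
  have \<eta>: "tau_steps Ps M t \<eta> u" and \<psi>: "opt_step Ps M u \<alpha> \<psi> t'"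
    using run by (simp_all add: matching_run_def)
  have "silent_steps (product_step P M) t u"
    using \<eta> sat(1) tau_steps_iff_silent_steps[OF assms] by blast
  moreover have "product_step P M u \<alpha> t' \<or> \<alpha> = Tau \<and> u = t'"
    using \<psi> sat(2) opt_step_iff_product_step[OF assms(1) tau_steps_in_states[OF \<eta>]] by blast
  moreover have "product_rel F Ps R P s u" "product_rel F Ps R P s' t'"
    using run sat(3,4) by (auto simp: matching_run_def product_rel_def)
  ultimately show "branching_match (product_step P M) (product_rel F Ps R P) s t \<alpha> s'"
    unfolding branching_match_def by blast
qed

lemma branching_match_iff_indexed_runs:
  assumes fin: "finite Ps" and t: "t \<in> states M"
  shows "(\<forall>P\<in>Ps. P \<Turnstile> \<chi> \<longrightarrow>
      branching_match (product_step P M) (product_rel F Ps R P) s t \<alpha> s') \<longleftrightarrow>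
    (\<exists>(n::nat) u t' \<eta> \<psi> \<phi>1 \<phi>2.
      (\<forall>i\<in>{1..n}. matching_run F Ps M R s t \<alpha> s' (u i) (t' i) (\<eta> i) (\<psi> i) (\<phi>1 i) (\<phi>2 i)) \<and>
      (\<forall>P\<in>Ps. P \<Turnstile> \<chi> \<longrightarrow>
         P \<Turnstile> big_or ((\<lambda>i. And (\<eta> i) (And (\<psi> i) (And (\<phi>1 i) (\<phi>2 i)))) ` {1..n})))"
    (is "?matched \<longleftrightarrow> ?covered")
proof
  assume ?matched
  define Q where "Q = {P \<in> Ps. P \<Turnstile> \<chi>}"
  have "\<forall>P\<in>Q. \<exists>u t' \<eta> \<psi> \<phi>1 \<phi>2. matching_run F Ps M R s t \<alpha> s' u t' \<eta> \<psi> \<phi>1 \<phi>2 \<and>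
      P \<Turnstile> And \<eta> (And \<psi> (And \<phi>1 \<phi>2))"
    using \<open>?matched\<close> branching_match_iff_matching_run[OF _ t] unfolding Q_def by blast
  then obtain u t' \<eta> \<psi> \<phi>1 \<phi>2 where
    runs: "\<forall>P\<in>Q. matching_run F Ps M R s t \<alpha> s' (u P) (t' P) (\<eta> P) (\<psi> P) (\<phi>1 P) (\<phi>2 P)"
    and cover: "\<forall>P\<in>Q. P \<Turnstile> And (\<eta> P) (And (\<psi> P) (And (\<phi>1 P) (\<phi>2 P)))"
    by metis
  have "finite Q"
    using fin by (simp add: Q_def)
  then obtain e where "bij_betw e {1..card Q} Q"
    using ex_bij_betw_nat_finite_1 by blast
  then have e: "e ` {1..card Q} = Q"
    by (rule bij_betw_imp_surj_on)
  show ?covered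
  proof (intro exI conjI ballI impI)
    show "matching_run F Ps M R s t \<alpha> s'
        (u (e i)) (t' (e i)) (\<eta> (e i)) (\<psi> (e i)) (\<phi>1 (e i)) (\<phi>2 (e i))"
      if "i \<in> {1..card Q}" for i
      using runs e that by blast
    fix P assume "P \<in> Ps" "P \<Turnstile> \<chi>"
    then have "P \<in> e ` {1..card Q}"
      unfolding e by (simp add: Q_def)
    with cover e
    show "P \<Turnstile> big_or
        ((\<lambda>i. And (\<eta> (e i)) (And (\<psi> (e i)) (And (\<phi>1 (e i)) (\<phi>2 (e i))))) ` {1..card Q})"
      by (subst sat_big_or) blast+
  qed
next
  assume ?covered
  then show ?matched
    by (simp add: branching_match_iff_matching_run t sat_big_or) blast
qed

lemma branching_feature_bisimulation_iff_match:
  assumes "finite Ps"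
  shows "branching_feature_bisimulation F Ps M R \<longleftrightarrow>
    R \<subseteq> states M \<times> (fexps F // feq F Ps) \<times> states M \<and>
    (\<forall>s c t. (s, c, t) \<in> R \<longrightarrow> (t, c, s) \<in> R) \<and>
    (\<forall>s t s' \<alpha>. \<forall>\<phi>\<in>fexps F. \<forall>\<psi>. (s, fclass F Ps \<phi>, t) \<in> R \<and> step Ps M s \<alpha> \<psi> s' \<longrightarrow>
      (\<forall>P\<in>Ps. P \<Turnstile> And \<phi> \<psi> \<longrightarrow>
        branching_match (product_step P M) (product_rel F Ps R P) s t \<alpha> s'))"
  unfolding branching_feature_bisimulation_def
  by (intro conj_cong iff_allI ball_cong imp_cong refl
      branching_match_iff_indexed_runs[OF assms, symmetric, unfolded matching_run_def]) blast

lemma branching_feature_bisimulation_iff_products: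
  assumes "finite Ps"
  shows "branching_feature_bisimulation F Ps M R \<longleftrightarrow>
    R \<subseteq> states M \<times> (fexps F // feq F Ps) \<times> states M \<and>
    (\<forall>s c t. (s, c, t) \<in> R \<longrightarrow> (t, c, s) \<in> R) \<and>
    (\<forall>P\<in>Ps. branching_bisimulation (product_step P M) (product_rel F Ps R P))"
proof -
  have "(\<forall>s t s' \<alpha>. \<forall>\<phi>\<in>fexps F. \<forall>\<psi>. (s, fclass F Ps \<phi>, t) \<in> R \<and> step Ps M s \<alpha> \<psi> s' \<longrightarrow>
      (\<forall>P\<in>Ps. P \<Turnstile> And \<phi> \<psi> \<longrightarrow>
        branching_match (product_step P M) (product_rel F Ps R P) s t \<alpha> s')) \<longleftrightarrow>
    (\<forall>P\<in>Ps. \<forall>s t \<alpha> s'. product_rel F Ps R P s t \<longrightarrow> product_step P M s \<alpha> s' \<longrightarrow>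
      branching_match (product_step P M) (product_rel F Ps R P) s t \<alpha> s')"
    by (auto simp: product_rel_def product_step_iff_step) blast
  moreover have "symp (product_rel F Ps R P)" if "\<forall>s c t. (s, c, t) \<in> R \<longrightarrow> (t, c, s) \<in> R" for P
    using that unfolding symp_def product_rel_def by blast
  ultimately show ?thesis
    unfolding branching_feature_bisimulation_iff_match[OF assms] branching_bisimulation_def
    by (intro conj_cong refl) simp
qed

section \<open>Coherence\<close>

definition coherent_product_bisimulation ::
  "'f set set \<Rightarrow> ('f, 'a, 's) fts \<Rightarrow> ('f, 'a, 't) fts \<Rightarrow>
   ('f set \<Rightarrow> 's + 't \<Rightarrow> 's + 't \<Rightarrow> bool) \<Rightarrow> bool" where
  "coherent_product_bisimulation Ps M N B \<longleftrightarrow>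
     (\<forall>P\<in>Ps. branching_bisimulation (product_step P (fts_union M N)) (B P) \<and>
        (\<forall>x y. B P x y \<longrightarrow> x \<in> states (fts_union M N) \<and> y \<in> states (fts_union M N)) \<and>
        B P (Inl (init M)) (Inr (init N))) \<and>
     (\<forall>P\<in>Ps. \<forall>Q\<in>Ps. \<forall>s y. B P (Inl s) y \<longrightarrow> reachable Ps M Q s \<longrightarrow> B Q (Inl s) y)"

lemma coherent_product_bisimulationD:
  assumes "coherent_product_bisimulation Ps M N B" "P \<in> Ps"
  shows "branching_bisimulation (product_step P (fts_union M N)) (B P)"
    and "B P x y \<Longrightarrow> x \<in> states (fts_union M N) \<and> y \<in> states (fts_union M N)"
    and "B P (Inl (init M)) (Inr (init N))"
    and "Q \<in> Ps \<Longrightarrow> B P (Inl s) y \<Longrightarrow> reachable Ps M Q s \<Longrightarrow> B Q (Inl s) y"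
  using assms unfolding coherent_product_bisimulation_def by blast+

text \<open>The non-emptiness condition keeps pairs that are related under no product out of the
  relation; coherence would demand that their first component be unreachable.\<close>

definition feature_rel ::
  "'f set \<Rightarrow> 'f set set \<Rightarrow> ('f set \<Rightarrow> 's \<Rightarrow> 's \<Rightarrow> bool) \<Rightarrow> ('s \<times> 'f fexp set \<times> 's) set" where
  "feature_rel F Ps B = {(x, fclass F Ps \<phi>, y) |x \<phi> y.
     \<phi> \<in> fexps F \<and> (\<exists>P\<in>Ps. B P x y) \<and> (\<forall>P\<in>Ps. P \<Turnstile> \<phi> \<longleftrightarrow> B P x y)}"

lemma feature_rel_iff:
  assumes "\<phi> \<in> fexps F"
  shows "(x, fclass F Ps \<phi>, y) \<in> feature_rel F Ps B \<longleftrightarrow>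
    (\<exists>P\<in>Ps. B P x y) \<and> (\<forall>P\<in>Ps. P \<Turnstile> \<phi> \<longleftrightarrow> B P x y)"
  using assms by (auto simp: feature_rel_def fclass_eq_iff)

lemma product_rel_feature_rel:
  assumes "finite F" "Ps \<subseteq> Pow F" "P \<in> Ps"
  shows "product_rel F Ps (feature_rel F Ps B) P = B P"
proof (intro ext iffI)
  fix x y assume "B P x y"
  obtain \<phi> where "\<phi> \<in> fexps F" "\<forall>P\<subseteq>F. P \<Turnstile> \<phi> \<longleftrightarrow> P \<in> {P \<in> Ps. B P x y}"
    using fexp_of_products[OF assms(1), of "{P \<in> Ps. B P x y}"] assms(2) by blast
  then show "product_rel F Ps (feature_rel F Ps B) P x y"
    using \<open>B P x y\<close> assms(2,3) unfolding product_rel_def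
    by (intro bexI[of _ \<phi>]) (auto simp: feature_rel_iff)
qed (auto simp: product_rel_def feature_rel_iff assms(3))

lemma coherent_iff_reachable:
  assumes "finite F" "Ps \<subseteq> Pow F"
  shows "coherent F Ps M R \<longleftrightarrow> (\<forall>s\<in>states M. \<forall>t. \<forall>\<phi>\<in>fexps F. (Inl s, fclass F Ps \<phi>, t) \<in> R \<longrightarrow>
    (\<forall>P\<in>Ps. reachable Ps M P s \<longrightarrow> P \<Turnstile> \<phi>))"
  by (simp add: coherent_def reach_fexp(2)[OF assms] cong: ball_cong)

lemma coherent_bf_bisimilar_imp_products:
  assumes F: "finite F" "Ps \<subseteq> Pow F" and bisimilar: "coherent_bf_bisimilar F Ps M N"
  shows "\<exists>B. coherent_product_bisimulation Ps M N B"
proof -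
  obtain R where R: "branching_feature_bisimulation F Ps (fts_union M N) R"
    "coherent F Ps M R" "(Inl (init M), fclass F Ps FTrue, Inr (init N)) \<in> R"
    using bisimilar by (auto simp: coherent_bf_bisimilar_def)
  have "finite Ps"
    using F finite_subset by auto
  note bfb = R(1)[unfolded branching_feature_bisimulation_iff_products[OF this]]
    and coherent = R(2)[unfolded coherent_iff_reachable[OF F]]
  have "coherent_product_bisimulation Ps M N (product_rel F Ps R)"
    unfolding coherent_product_bisimulation_def
  proof (intro conjI ballI allI impI)
    fix P Q s y
    assume Q: "Q \<in> Ps" "reachable Ps M Q s" and "product_rel F Ps R P (Inl s) y"
    then obtain \<phi> where \<phi>: "\<phi> \<in> fexps F" "(Inl s, fclass F Ps \<phi>, y) \<in> R"
      by (auto simp: product_rel_def)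
    then have "s \<in> states M"
      using bfb by (auto simp: fts_union_def)
    with \<phi> Q coherent show "product_rel F Ps R Q (Inl s) y"
      unfolding product_rel_def by blast
  next
    fix P assume "P \<in> Ps"
    with bfb show "branching_bisimulation (product_step P (fts_union M N)) (product_rel F Ps R P)"
      by blast
    show "product_rel F Ps R P (Inl (init M)) (Inr (init N))"
      using R(3) by (force simp: product_rel_def fexps_def)
    fix x y assume "product_rel F Ps R P x y"
    with bfb show "x \<in> states (fts_union M N)" "y \<in> states (fts_union M N)"
      by (auto simp: product_rel_def)
  qed
  then show ?thesis
    by blast
qed

lemma coherent_product_bisimulation_imp_bisimilar:
  assumes F: "finite F" "Ps \<subseteq> Pow F" and Ps: "Ps \<noteq> {}"
    and B: "coherent_product_bisimulation Ps M N B"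
  shows "coherent_bf_bisimilar F Ps M N"
proof -
  let ?R = "feature_rel F Ps B"
  have sym: "B P x y \<longleftrightarrow> B P y x" if "P \<in> Ps" for P x y
    using branching_bisimulation_symD[OF coherent_product_bisimulationD(1)[OF B that]] by blast
  have "finite Ps"
    using F finite_subset by auto
  have "branching_feature_bisimulation F Ps (fts_union M N) ?R"
    unfolding branching_feature_bisimulation_iff_products[OF \<open>finite Ps\<close>]
  proof (intro conjI allI impI ballI)
    show "?R \<subseteq> states (fts_union M N) \<times> (fexps F // feq F Ps) \<times> states (fts_union M N)"
      using coherent_product_bisimulationD(2)[OF B]
      by (auto simp: feature_rel_def fclass_def intro: quotientI)
    show "(y, c, x) \<in> ?R" if "(x, c, y) \<in> ?R" for x c y
      using that sym by (auto simp: feature_rel_def)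
    show "branching_bisimulation (product_step P (fts_union M N)) (product_rel F Ps ?R P)"
      if "P \<in> Ps" for P
      using coherent_product_bisimulationD(1)[OF B that]
      by (simp add: product_rel_feature_rel[OF F that])
  qed
  moreover have "coherent F Ps M ?R"
    unfolding coherent_iff_reachable[OF F]
    by (auto simp: feature_rel_iff intro: coherent_product_bisimulationD(4)[OF B])
  moreover have "(Inl (init M), fclass F Ps FTrue, Inr (init N)) \<in> ?R"
  proof -
    have "FTrue \<in> fexps F"
      by (simp add: fexps_def)
    then show ?thesis
      using coherent_product_bisimulationD(3)[OF B] Ps by (auto simp: feature_rel_iff)
  qed
  ultimately show ?thesis
    unfolding coherent_bf_bisimilar_def by blast
qed

lemma minimal_coherent_bf_bisimilar_card_le:
  fixes L :: "('f, 'a, nat) fts"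
  assumes "minimal_coherent_bf_bisimilar F Ps M N"
    and "is_fts F L" "coherent_bf_bisimilar F Ps M L" "finite (states L)"
  shows "finite (states N)" "card (states N) \<le> card (states L)"
proof -
  have "states N \<lesssim> states L"
    using assms(1-3) unfolding minimal_coherent_bf_bisimilar_def by blast
  then obtain f where "inj_on f (states N)" "f ` states N \<subseteq> states L"
    by (auto simp: lepoll_def)
  then show "finite (states N)" "card (states N) \<le> card (states L)"
    using assms(4) by (auto intro: inj_on_finite card_inj_on_le)
qed

section \<open>Matching reachable states\<close>

lemma product_step_fts_union_Inl:
  "product_step P (fts_union M N) (Inl s) \<alpha> y \<longleftrightarrow> (\<exists>s'. y = Inl s' \<and> product_step P M s \<alpha> s')"
  by (cases y) (auto simp: product_step_def fts_union_def)

lemma product_step_fts_union_Inr: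
  "product_step P (fts_union M N) (Inr t) \<alpha> y \<longleftrightarrow> (\<exists>t'. y = Inr t' \<and> product_step P N t \<alpha> t')"
  by (cases y) (auto simp: product_step_def fts_union_def)

lemma reachable_product_step:
  "P \<in> Ps \<Longrightarrow> reachable Ps M P s \<Longrightarrow> product_step P M s \<alpha> s' \<Longrightarrow> reachable Ps M P s'"
  by (auto simp: product_step_iff_step intro: reachable.step)

lemma reachable_in_states:
  "init M \<in> states M \<Longrightarrow> reachable Ps M P s \<Longrightarrow> s \<in> states M"
  by (auto simp: step_def elim: reachable.cases)

lemma reachable_state_matched_uniformly:
  assumes B: "coherent_product_bisimulation Ps M N B" and P: "P \<in> Ps" and "reachable Ps M P s"
  shows "\<exists>t\<in>states N. \<forall>Q\<in>Ps. reachable Ps M Q s \<longrightarrow> B Q (Inl s) (Inr t)"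
  using assms(3)
proof induction
  case init
  have "init N \<in> states N"
    using coherent_product_bisimulationD(2)[OF B P coherent_product_bisimulationD(3)[OF B P]]
    by (auto simp: fts_union_def)
  then show ?case
    using coherent_product_bisimulationD(3)[OF B] by blast
next
  case (step s \<alpha> \<psi> s')
  let ?T = "product_step P (fts_union M N)"
  obtain t where t: "B P (Inl s) (Inr t)"
    using step.IH step.hyps(1) P by blast
  have "?T (Inl s) \<alpha> (Inl s')"
    using step.hyps(2,3) P by (auto simp: product_step_fts_union_Inl product_step_iff_step)
  with coherent_product_bisimulationD(1)[OF B P] t obtain u y where
    u: "silent_steps ?T (Inr t) u" "?T u \<alpha> y \<or> \<alpha> = Tau \<and> u = y" and y: "B P (Inl s') y"
    by (rule branching_bisimulation_stepE)
  obtain w where "u = Inr w"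
    using silent_steps_image[of ?T Inr "product_step P N", OF product_step_fts_union_Inr u(1)]
    by blast
  with u(2) obtain t' where t': "y = Inr t'"
    by (auto simp: product_step_fts_union_Inr)
  have "t' \<in> states N"
    using coherent_product_bisimulationD(2)[OF B P y] by (auto simp: t' fts_union_def)
  moreover have "\<forall>Q\<in>Ps. reachable Ps M Q s' \<longrightarrow> B Q (Inl s') (Inr t')"
    using coherent_product_bisimulationD(4)[OF B P _ y] t' by blast
  ultimately show ?case
    by blast
qed

theorem coherent_bf_bisimilar_state_map:
  assumes "finite F" "Ps \<subseteq> Pow F" "coherent_bf_bisimilar F Ps M N"
  obtains g where
    "\<And>P s. P \<in> Ps \<Longrightarrow> reachable Ps M P s \<Longrightarrow> g s \<in> states N"
    "\<And>P s r. P \<in> Ps \<Longrightarrow> reachable Ps M P s \<Longrightarrow> reachable Ps M P r \<Longrightarrow> g s = g r \<Longrightarrow>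
      branching_bisimilar (product_step P M) s r"
proof -
  obtain B where B: "coherent_product_bisimulation Ps M N B"
    using coherent_bf_bisimilar_imp_products[OF assms] ..
  have "\<exists>t. \<forall>P\<in>Ps. reachable Ps M P s \<longrightarrow> t \<in> states N \<and> B P (Inl s) (Inr t)" for s
    using reachable_state_matched_uniformly[OF B, of _ s] by blast
  then obtain g where
    g: "\<And>P s. P \<in> Ps \<Longrightarrow> reachable Ps M P s \<Longrightarrow> g s \<in> states N"
      "\<And>P s. P \<in> Ps \<Longrightarrow> reachable Ps M P s \<Longrightarrow> B P (Inl s) (Inr (g s))"
    by metis
  moreover have "branching_bisimilar (product_step P M) s r"
    if P: "P \<in> Ps" "reachable Ps M P s" "reachable Ps M P r" "g s = g r" for P s r
  proof -
    have bfb: "branching_bisimulation (product_step P (fts_union M N)) (B P)"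
      using B P(1) by (rule coherent_product_bisimulationD(1))
    have "branching_bisimulation (product_step P M) (\<lambda>s r. (B P OO B P) (Inl s) (Inl r))"
      using product_step_fts_union_Inl branching_bisimulation_relcompp[OF bfb]
      by (rule branching_bisimulation_vimage)
    moreover have "(B P OO B P) (Inl s) (Inl r)"
      using g(2)[OF P(1,2)] g(2)[OF P(1,3)] P(4) branching_bisimulation_symD[OF bfb] by auto
    ultimately show ?thesis
      unfolding branching_bisimilar_def by blast
  qed
  ultimately show thesis
    using that by blast
qed

section \<open>Quotients\<close>

definition sum_rel :: "('s \<Rightarrow> 't \<Rightarrow> bool) \<Rightarrow> 's + 't \<Rightarrow> 's + 't \<Rightarrow> bool" where
  "sum_rel Z x y \<longleftrightarrow> (\<exists>s t. Z s t \<and> (x = Inl s \<and> y = Inr t \<or> x = Inr t \<and> y = Inl s))"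

lemma sum_rel_simps [simp]:
  "sum_rel Z (Inl s) (Inr t) \<longleftrightarrow> Z s t" "sum_rel Z (Inr t) (Inl s) \<longleftrightarrow> Z s t"
  by (auto simp: sum_rel_def)

lemma branching_bisimulation_sum_rel:
  assumes forward: "\<And>s t \<alpha> s'. Z s t \<Longrightarrow> product_step P M s \<alpha> s' \<Longrightarrow>
      \<exists>t'. product_step P N t \<alpha> t' \<and> Z s' t'"
    and backward: "\<And>s t \<alpha> t'. Z s t \<Longrightarrow> product_step P N t \<alpha> t' \<Longrightarrow>
      \<exists>s'. product_step P M s \<alpha> s' \<and> Z s' t'"
  shows "branching_bisimulation (product_step P (fts_union M N)) (sum_rel Z)"
  unfolding branching_bisimulation_def
proof (intro conjI allI impI)
  show "symp (sum_rel Z)"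
    by (auto simp: symp_def sum_rel_def)
next
  let ?T = "product_step P (fts_union M N)"
  fix x y \<alpha> x'
  assume rel: "sum_rel Z x y" and "?T x \<alpha> x'"
  then have "\<exists>y'. ?T y \<alpha> y' \<and> sum_rel Z x' y'"
    unfolding sum_rel_def[of Z x y]
    by (elim exE disjE conjE)
      (fastforce simp: product_step_fts_union_Inl product_step_fts_union_Inr
        dest: forward backward)+
  with rel show "branching_match ?T (sum_rel Z) x y \<alpha> x'"
    unfolding branching_match_def by blast
qed

definition quotient_fts :: "('s \<Rightarrow> 't) \<Rightarrow> ('f, 'a, 's) fts \<Rightarrow> ('f, 'a, 't) fts" where
  "quotient_fts h M = \<lparr>states = h ` states M,
     constr = \<lambda>x \<alpha> y. big_or ((\<lambda>(s, s'). constr M s \<alpha> s') `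
       {(s, s') \<in> states M \<times> states M. h s = x \<and> h s' = y}),
     init = h (init M)\<rparr>"

lemma finite_state_pairs: "finite A \<Longrightarrow> finite {(s, s') \<in> A \<times> A. h s = x \<and> h s' = y}"
  by (rule finite_subset[of _ "A \<times> A"]) auto

lemma product_step_quotient:
  assumes "finite (states M)"
  shows "product_step P (quotient_fts h M) x \<alpha> y \<longleftrightarrow>
    (\<exists>s s'. h s = x \<and> h s' = y \<and> product_step P M s \<alpha> s')"
  using finite_state_pairs[OF assms, of h x y]
  by (auto simp: product_step_def quotient_fts_def sat_big_or)

lemma is_fts_quotient:
  assumes "finite (states M)" "is_fts F M"
  shows "is_fts F (quotient_fts h M)"
  using assms finite_state_pairs[OF assms(1), of h]
  unfolding is_fts_def quotient_fts_def by (auto intro!: big_or_in_fexps)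

theorem quotient_bisimilar:
  assumes F: "finite F" "Ps \<subseteq> Pow F" and "Ps \<noteq> {}"
    and fin: "finite (states M)" and init: "init M \<in> states M"
    and lift: "\<And>P s r \<alpha> r'. P \<in> Ps \<Longrightarrow> reachable Ps M P s \<Longrightarrow> h s = h r \<Longrightarrow>
        product_step P M r \<alpha> r' \<Longrightarrow> \<exists>s'. h s' = h r' \<and> product_step P M s \<alpha> s'"
  shows "coherent_bf_bisimilar F Ps M (quotient_fts h M)"
proof -
  let ?N = "quotient_fts h M"
  define Z where "Z P s t \<longleftrightarrow> reachable Ps M P s \<and> t = h s" for P s t
  have "branching_bisimulation (product_step P (fts_union M ?N)) (sum_rel (Z P))"
    if P: "P \<in> Ps" for P
  proof (rule branching_bisimulation_sum_rel)
    fix s t \<alpha> s' assume "Z P s t" "product_step P M s \<alpha> s'"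
    then show "\<exists>t'. product_step P ?N t \<alpha> t' \<and> Z P s' t'"
      using reachable_product_step[OF P] by (auto simp: Z_def product_step_quotient[OF fin])
  next
    fix s t \<alpha> t' assume Z: "Z P s t" and "product_step P ?N t \<alpha> t'"
    then obtain r r' where "h s = h r" "h r' = t'" "product_step P M r \<alpha> r'"
      unfolding Z_def product_step_quotient[OF fin] by metis
    then show "\<exists>s'. product_step P M s \<alpha> s' \<and> Z P s' t'"
      using lift[OF P] Z reachable_product_step[OF P] unfolding Z_def by metis
  qed
  moreover have "x \<in> states (fts_union M ?N) \<and> y \<in> states (fts_union M ?N)"
    if "sum_rel (Z P) x y" for P x y
    using that reachable_in_states[OF init]
    by (auto simp: sum_rel_def Z_def fts_union_def quotient_fts_def)
  moreover have "sum_rel (Z P) (Inl (init M)) (Inr (init ?N))" for P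
    by (simp add: Z_def quotient_fts_def reachable.init)
  moreover have "sum_rel (Z Q) (Inl s) y"
    if "sum_rel (Z P) (Inl s) y" "reachable Ps M Q s" for P Q s y
    using that by (auto simp: sum_rel_def Z_def)
  ultimately have "coherent_product_bisimulation Ps M ?N (\<lambda>P. sum_rel (Z P))"
    unfolding coherent_product_bisimulation_def by blast
  with F \<open>Ps \<noteq> {}\<close> show ?thesis
    by (rule coherent_product_bisimulation_imp_bisimilar)
qed

section \<open>Colourings\<close>

lemma proper_colouring_of_edge_separating_map:
  assumes "finite V" "\<And>u v. u \<in> V \<Longrightarrow> v \<in> V \<Longrightarrow> {u, v} \<in> E \<Longrightarrow> g u \<noteq> g v"
  obtains c where "proper_colouring V E (card (g ` V)) c"
proof -
  obtain e where e: "bij_betw e (g ` V) {0..<card (g ` V)}"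
    using ex_bij_betw_finite_nat[of "g ` V"] assms(1) by blast
  have "e (g v) < card (g ` V)" if "v \<in> V" for v
    using bij_betwE[OF e] that by auto
  moreover have "e (g u) \<noteq> e (g v)" if "u \<in> V" "v \<in> V" "{u, v} \<in> E" for u v
    using that assms(2) inj_onD[OF bij_betw_imp_inj_on[OF e]] by blast
  ultimately have "proper_colouring V E (card (g ` V)) (e \<circ> g)"
    by (auto simp: proper_colouring_def)
  then show thesis
    by (rule that)
qed

lemma chromatic_number_le_card_image:
  assumes "finite V" "\<And>u v. u \<in> V \<Longrightarrow> v \<in> V \<Longrightarrow> {u, v} \<in> E \<Longrightarrow> g u \<noteq> g v"
  shows "chromatic_number V E \<le> card (g ` V)"
proof -
  obtain c where "proper_colouring V E (card (g ` V)) c"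
    using assms by (rule proper_colouring_of_edge_separating_map)
  then show ?thesis
    unfolding chromatic_number_def by (blast intro: Least_le)
qed

lemma finite_graph_edgeD:
  assumes "finite_graph V E" "{u, v} \<in> E"
  shows "u \<in> V" "v \<in> V" "u \<noteq> v"
  using assms by (auto simp: finite_graph_def)

lemma proper_colouring_chromatic_number:
  assumes "finite_graph V E"
  obtains c where "proper_colouring V E (chromatic_number V E) c"
proof -
  obtain c where "proper_colouring V E (card (id ` V)) c"
  proof (rule proper_colouring_of_edge_separating_map)
    show "finite V"
      using assms by (simp add: finite_graph_def)
    show "id u \<noteq> id v" if "{u, v} \<in> E" for u v
      using finite_graph_edgeD(3)[OF assms that] by simp
  qed
  then have "\<exists>k c. proper_colouring V E k c"
    by blast
  from LeastI_ex[OF this] show thesis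
    unfolding chromatic_number_def[symmetric] by (blast intro: that)
qed

section \<open>The system of a graph\<close>

lemma graph_features_products:
  assumes "finite_graph V E"
  shows "finite (graph_features V)" "graph_products V \<subseteq> Pow (graph_features V)"
    "graph_products V \<noteq> {}"
  using assms by (auto simp: graph_features_def graph_products_def finite_graph_def)

lemma singleton_in_graph_products: "u \<in> V \<Longrightarrow> {Feature u} \<in> graph_products V"
  by (auto simp: graph_products_def)

lemma finite_states_graph:
  "finite_graph V E \<Longrightarrow> finite (states (graph_fts V E))"
  by (simp add: finite_graph_def graph_fts_def)

lemma finite_neighbour_atoms:
  assumes "finite_graph V E"
  shows "finite {Atom (Feature u) |u. {u, v} \<in> E}"
  by (rule finite_subset[of _ "(Atom \<circ> Feature) ` V"])
    (use assms in \<open>auto simp: finite_graph_def\<close>)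

lemma is_fts_graph:
  assumes "finite_graph V E"
  shows "is_fts (graph_features V) (graph_fts V E)"
proof -
  have "big_or {Atom (Feature u) |u. {u, v} \<in> E} \<in> fexps (graph_features V)" for v
    using finite_graph_edgeD[OF assms]
    by (intro big_or_in_fexps finite_neighbour_atoms[OF assms])
      (auto simp: fexps_def graph_features_def)
  then have "graph_constr E s \<alpha> s' \<in> fexps (graph_features V)"
    if "s \<in> states (graph_fts V E)" "s' \<in> states (graph_fts V E)" for s \<alpha> s'
    using that
    by (cases "(E, s, \<alpha>, s')" rule: graph_constr.cases)
      (auto simp: fexps_def graph_features_def graph_fts_def)
  then show ?thesis
    by (simp add: is_fts_def graph_fts_def)
qed

definition closed_neighbourhood :: "'v set \<Rightarrow> 'v set set \<Rightarrow> 'v \<Rightarrow> 'v set" where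
  "closed_neighbourhood V E u = {v \<in> V. {u, v} \<in> E \<or> u = v}"

definition reachable_gstates :: "'v set \<Rightarrow> 'v set set \<Rightarrow> 'v \<Rightarrow> 'v gstate set" where
  "reachable_gstates V E u = {S1, S2} \<union> SV ` closed_neighbourhood V E u"

lemma self_in_closed_neighbourhood: "u \<in> V \<Longrightarrow> u \<in> closed_neighbourhood V E u"
  by (simp add: closed_neighbourhood_def)

lemma product_step_graph:
  assumes "finite_graph V E" "u \<in> V"
  shows "product_step {Feature u} (graph_fts V E) s \<alpha> s' \<longleftrightarrow> \<alpha> = Act () \<and>
    (s = S1 \<and> s' \<in> SV ` closed_neighbourhood V E u \<or> s = SV u \<and> s' = S2)"
proof -
  have "{Feature u} \<Turnstile> big_or {Atom (Feature w) |w. {w, v} \<in> E} \<longleftrightarrow> {u, v} \<in> E" for v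
    by (auto simp: sat_big_or[OF finite_neighbour_atoms[OF assms(1)]])
  then show ?thesis
    using assms(2) by (cases s; cases \<alpha>; cases s')
      (auto simp: product_step_def graph_fts_def closed_neighbourhood_def)
qed

lemma reachable_graph_iff:
  assumes G: "finite_graph V E" and u: "u \<in> V"
  shows "reachable (graph_products V) (graph_fts V E) {Feature u} s \<longleftrightarrow>
    s \<in> reachable_gstates V E u"
proof -
  let ?M = "graph_fts V E" and ?P = "{Feature u}"
  let ?reach = "reachable (graph_products V) ?M ?P"
  note P = singleton_in_graph_products[OF u]
  note step_iff = product_step_graph[OF G u] and step_reachable = reachable_product_step[OF P]
  have S1: "?reach S1"
    using reachable.init[of "graph_products V" ?M] by (simp add: graph_fts_def)
  have SV: "?reach (SV v)" if "v \<in> closed_neighbourhood V E u" for v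
    using that by (intro step_reachable[OF S1, of "Act ()"]) (simp add: step_iff)
  have "?reach S2"
    using SV[OF self_in_closed_neighbourhood[OF u]]
    by (rule step_reachable[of _ _ "Act ()"]) (simp add: step_iff)
  moreover have "s \<in> reachable_gstates V E u" if "?reach s"
    using that
  proof cases
    case (step r \<alpha> \<psi>)
    then have "product_step ?P ?M r \<alpha> s"
      using P by (auto simp: product_step_iff_step)
    then show ?thesis
      by (auto simp: step_iff reachable_gstates_def)
  qed (simp add: graph_fts_def reachable_gstates_def)
  ultimately show ?thesis
    using S1 SV by (auto simp: reachable_gstates_def)
qed

primrec colour_gstate :: "nat \<Rightarrow> ('v \<Rightarrow> nat) \<Rightarrow> 'v gstate \<Rightarrow> nat" where
  "colour_gstate k c S1 = k"
| "colour_gstate k c S2 = k + 1"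
| "colour_gstate k c (SV v) = c v"

lemma card_states_colour_quotient:
  assumes "proper_colouring V E k c"
  shows "card (states (quotient_fts (colour_gstate k c) (graph_fts V E))) \<le> k + 2"
proof -
  have "states (quotient_fts (colour_gstate k c) (graph_fts V E)) \<subseteq> {..<k + 2}"
    using assms by (fastforce simp: quotient_fts_def graph_fts_def proper_colouring_def)
  from card_mono[OF _ this] show ?thesis
    by simp
qed

lemma colour_quotient_bisimilar:
  assumes G: "finite_graph V E" and c: "proper_colouring V E k c"
  shows "coherent_bf_bisimilar (graph_features V) (graph_products V) (graph_fts V E)
    (quotient_fts (colour_gstate k c) (graph_fts V E))"
proof (rule quotient_bisimilar[OF graph_features_products[OF G] finite_states_graph[OF G]])
  let ?M = "graph_fts V E" and ?h = "colour_gstate k c"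
  show "init ?M \<in> states ?M"
    by (simp add: graph_fts_def)
  fix P s r \<alpha> r'
  assume "P \<in> graph_products V" and reach: "reachable (graph_products V) ?M P s"
    and h: "?h s = ?h r" and st: "product_step P ?M r \<alpha> r'"
  then obtain u where u: "u \<in> V" "P = {Feature u}"
    by (auto simp: graph_products_def)
  have s: "s \<in> {S1, S2} \<union> SV ` closed_neighbourhood V E u"
    using reach u by (simp add: reachable_graph_iff[OF G] reachable_gstates_def)
  have below: "c v < k" if "v \<in> closed_neighbourhood V E u" for v
    using c that by (auto simp: closed_neighbourhood_def proper_colouring_def)
  have unique: "v = u" if "v \<in> closed_neighbourhood V E u" "c v = c u" for v
    using that c u(1) unfolding closed_neighbourhood_def proper_colouring_def by force
  have "r \<in> {S1, SV u}"
    using st u by (auto simp: product_step_graph[OF G])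
  then have "s = r"
    using s h below[OF self_in_closed_neighbourhood[OF u(1)]] by (auto dest: below unique)
  with st show "\<exists>s'. ?h s' = ?h r' \<and> product_step P ?M s \<alpha> s'"
    by blast
qed

lemma branching_bisimilar_graph_eq:
  assumes G: "finite_graph V E" and u: "u \<in> V"
    and bisimilar: "branching_bisimilar (product_step {Feature u} (graph_fts V E)) s r"
    and s: "s \<in> {S1, SV u}"
  shows "s = r"
proof -
  let ?T = "product_step {Feature u} (graph_fts V E)"
  note step_iff = product_step_graph[OF G u]
  have tau_free: "\<not> ?T t Tau t'" for t t'
    by (simp add: step_iff)
  have u_step: "?T S1 (Act ()) (SV u)" "?T (SV u) (Act ()) S2"
    using self_in_closed_neighbourhood[OF u] by (auto simp: step_iff)
  have mobile: "t' \<in> {S1, SV u}"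
    if related: "branching_bisimilar ?T t t'" and t: "t \<in> {S1, SV u}" for t t'
  proof -
    obtain t'' where "?T t (Act ()) t''"
      using t u_step by blast
    from branching_bisimilar_visible_step[OF related this tau_free] show ?thesis
      by (auto simp: step_iff)
  qed
  have "\<not> branching_bisimilar ?T S1 (SV u)"
  proof
    assume "branching_bisimilar ?T S1 (SV u)"
    from branching_bisimilar_visible_step[OF this u_step(1) tau_free]
    obtain t where "?T (SV u) (Act ()) t" "branching_bisimilar ?T (SV u) t"
      by blast
    then show False
      using mobile[of "SV u" t] by (auto simp only: step_iff gstate.distinct)
  qed
  then show ?thesis
    using mobile[OF bisimilar s] s bisimilar branching_bisimilar_sym[OF bisimilar] by auto
qed

lemma graph_bisimilar_state_map:
  assumes G: "finite_graph V E"
    and bisimilar: "coherent_bf_bisimilar (graph_features V) (graph_products V) (graph_fts V E) N"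
  obtains g where
    "\<And>u s. u \<in> V \<Longrightarrow> s \<in> reachable_gstates V E u \<Longrightarrow> g s \<in> states N"
    "\<And>u s r. u \<in> V \<Longrightarrow> s \<in> {S1, SV u} \<Longrightarrow> r \<in> reachable_gstates V E u \<Longrightarrow> s \<noteq> r \<Longrightarrow> g s \<noteq> g r"
proof -
  let ?Ps = "graph_products V" and ?M = "graph_fts V E"
  obtain g where in_states: "\<And>P s. P \<in> ?Ps \<Longrightarrow> reachable ?Ps ?M P s \<Longrightarrow> g s \<in> states N"
    and bisimilar_fibres: "\<And>P s r. P \<in> ?Ps \<Longrightarrow> reachable ?Ps ?M P s \<Longrightarrow> reachable ?Ps ?M P r \<Longrightarrow>
      g s = g r \<Longrightarrow> branching_bisimilar (product_step P ?M) s r"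
    using graph_features_products(1,2)[OF G] bisimilar
    by (rule coherent_bf_bisimilar_state_map) metis
  show thesis
  proof
    show "g s \<in> states N" if "u \<in> V" "s \<in> reachable_gstates V E u" for u s
      using in_states[OF singleton_in_graph_products] that by (simp add: reachable_graph_iff[OF G])
    show "g s \<noteq> g r"
      if u: "u \<in> V" and s: "s \<in> {S1, SV u}" and r: "r \<in> reachable_gstates V E u" and "s \<noteq> r"
      for u s r
    proof
      assume "g s = g r"
      moreover have "s \<in> reachable_gstates V E u"
        using u s by (auto simp: reachable_gstates_def self_in_closed_neighbourhood)
      ultimately have "branching_bisimilar (product_step {Feature u} ?M) s r"
        using u r by (intro bisimilar_fibres singleton_in_graph_products)
          (simp_all add: reachable_graph_iff[OF G])
      from branching_bisimilar_graph_eq[OF G u this s] \<open>s \<noteq> r\<close> show False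
        by contradiction
    qed
  qed
qed

lemma chromatic_number_plus_two_le_card_states:
  assumes G: "finite_graph V E" and fin: "finite (states N)"
    and "coherent_bf_bisimilar (graph_features V) (graph_products V) (graph_fts V E) N"
  shows "chromatic_number V E + 2 \<le> card (states N)"
proof -
  obtain g where in_states: "\<And>u s. u \<in> V \<Longrightarrow> s \<in> reachable_gstates V E u \<Longrightarrow> g s \<in> states N"
    and separated: "\<And>u s r. u \<in> V \<Longrightarrow> s \<in> {S1, SV u} \<Longrightarrow> r \<in> reachable_gstates V E u \<Longrightarrow>
      s \<noteq> r \<Longrightarrow> g s \<noteq> g r"
    using assms(1,3) by (rule graph_bisimilar_state_map) blast
  let ?C = "(\<lambda>v. g (SV v)) ` V"
  have "g (SV u) \<noteq> g (SV v)" if "u \<in> V" "v \<in> V" "{u, v} \<in> E" for u v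
    using that finite_graph_edgeD(3)[OF G that(3)]
    by (intro separated[of u]) (auto simp: reachable_gstates_def closed_neighbourhood_def)
  then have colours: "chromatic_number V E \<le> card ?C"
    using G by (intro chromatic_number_le_card_image) (auto simp: finite_graph_def)
  have "g (SV v) \<noteq> g S1" "g (SV v) \<noteq> g S2" if "v \<in> V" for v
    using separated[OF that, of "SV v"] by (simp_all add: reachable_gstates_def)
  then have fresh: "g S1 \<notin> ?C" "g S2 \<notin> ?C"
    by (metis imageE)+
  obtain w where w: "w \<in> V"
    using G by (auto simp: finite_graph_def)
  have "g S1 \<noteq> g S2"
    using separated[OF w, of S1 S2] by (simp add: reachable_gstates_def)
  with colours fresh have "chromatic_number V E + 2 \<le> card ({g S1, g S2} \<union> ?C)"
    using G by (simp add: finite_graph_def)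
  also have "\<dots> \<le> card (states N)"
  proof (rule card_mono[OF fin])
    have "g (SV v) \<in> states N" if "v \<in> V" for v
      using in_states[OF that] that
      by (simp add: reachable_gstates_def self_in_closed_neighbourhood)
    then show "{g S1, g S2} \<union> ?C \<subseteq> states N"
      using in_states[OF w] by (auto simp: reachable_gstates_def)
  qed
  finally show ?thesis .
qed

theorem theorem8:
  fixes V :: "'v set" and E :: "'v set set"
    and S' :: "('v feature, unit, 's) fts"
  assumes "finite_graph V E"
    and "minimal_coherent_bf_bisimilar (graph_features V) (graph_products V) (graph_fts V E) S'"
  shows "card (states S') = chromatic_number V E + 2"
proof -
  let ?k = "chromatic_number V E"
  obtain c where c: "proper_colouring V E ?k c"
    using assms(1) by (rule proper_colouring_chromatic_number)
  let ?L = "quotient_fts (colour_gstate ?k c) (graph_fts V E)"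
  have "is_fts (graph_features V) ?L"
    using finite_states_graph[OF assms(1)] is_fts_graph[OF assms(1)] by (rule is_fts_quotient)
  moreover have "coherent_bf_bisimilar (graph_features V) (graph_products V) (graph_fts V E) ?L"
    using assms(1) c by (rule colour_quotient_bisimilar)
  moreover have "finite (states ?L)"
    using finite_states_graph[OF assms(1)] by (simp add: quotient_fts_def)
  ultimately have S': "finite (states S')" "card (states S') \<le> card (states ?L)"
    by (rule minimal_coherent_bf_bisimilar_card_le[OF assms(2)])+
  have "card (states ?L) \<le> ?k + 2"
    using c by (rule card_states_colour_quotient)
  moreover have "?k + 2 \<le> card (states S')"
    using assms S'(1) unfolding minimal_coherent_bf_bisimilar_def
    by (intro chromatic_number_plus_two_le_card_states) simp_all
  ultimately show ?thesis
    using S'(2) by simp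
qed

end
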